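(* Let $p,q$ be nonzero complex numbers with $p^2\neq q^2$, $pq\neq 1$, $p^2\neq 1$, $q^2\neq 1$, and let $j\in\mathbb{C}$ be arbitrary (not necessarily integral or half-integral). Let $W_j$ be the highest weight representation of $U_{p,q}[sl(2)]$ with basis $|j,j-n\rangle$, $n=0,1,2,\dots$, defined in the context. Then $W_j$ is reducible and contains a nonzero finite-dimensional subrepresentation if and only if the equation $$f(x)\equiv q^{2j-x}[x+1]_q-p^{-2j+x}[x+1]_p=0$$ has a non-negative integer solution $x$.
   Context: Conventions: fix values of $\log p$ and $\log q$, and set $q^z=e^{z\log q}$, $p^z=e^{z\log p}$ for $z\in\mathbb{C}$. For an integer $n$ put $[n]_q=\frac{q^n-q^{-n}}{q-q^{-1}}$, $[n]_p=\frac{p^n-p^{-n}}{p-p^{-1}}$. For $x$ a number or a diagonal operator put $[x]_{p,q}=\frac{q^x-p^{-x}}{q-p^{-1}}$. The two-parametric quantum group $U_{p,q}[sl(2)]$ is generated by $E_+,E_-,H$ with relations $$[H,E_\pm]=\pm E_\pm,\qquad [E_+,E_-]=[2H]_{p,q}.$$ A representation means a complex vector space with operators $E_+,E_-,H$ satisfying these relations ($H$ diagonalizable in the given basis, so $[2H]_{p,q}$ acts on an $H$-eigenvector of eigenvalue $m$ as the scalar $[2m]_{p,q}$). A subrepresentation is a linear subspace invariant under $E_+,E_-,H$. A representation is reducible if it has a subrepresentation other than $0$ and the whole space. The representation $W_j$ is the complex vector space with basis $|j,m\rangle$, $m=j-n$, $n\in\{0,1,2,\dots\}$, with action $$H|j,m\rangle=m|j,m\rangle,$$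 $$E_+|j,m\rangle=\left(\frac{q^{j+m+1}[j-m]_q-p^{-j-m-1}[j-m]_p}{q-p^{-1}}\right)^{1/2}|j,m+1\rangle,$$ $$E_-|j,m\rangle=\left(\frac{q^{j+m}[j-m+1]_q-p^{-j-m}[j-m+1]_p}{q-p^{-1}}\right)^{1/2}|j,m-1\rangle,$$ where $E_+|j,j\rangle=0$. The number under the root in the coefficient of $E_-$ on $|j,m\rangle$ equals the number under the root in the coefficient of $E_+$ on $|j,m-1\rangle$; for each $m$ one square root of it is fixed and used in both formulas. *)

theory Defs
  imports Complex_Main "HOL-Library.Poly_Mapping"
begin

text \<open>The first argument is the chosen value of the logarithm of the base, so that
  \<open>cpow lq z\<close> is $q^z$ when \<open>exp lq = q\<close>.\<close>

definition cpow :: "complex \<Rightarrow> complex \<Rightarrow> complex" where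
  "cpow l z = exp (z * l)"

definition qnum :: "complex \<Rightarrow> int \<Rightarrow> complex" where
  "qnum q n = (q powi n - q powi (- n)) / (q - inverse q)"

definition pqnum :: "complex \<Rightarrow> complex \<Rightarrow> complex \<Rightarrow> complex" where
  "pqnum lp lq x = (cpow lq x - cpow lp (- x)) / (exp lq - inverse (exp lp))"

text \<open>Since \<open>H\<close> is diagonalizable, the operator \<open>[2H]\<close> is determined by its action on
  eigenvectors of \<open>H\<close>, which span the space.\<close>

definition is_rep ::
  "complex \<Rightarrow> complex \<Rightarrow> (complex \<Rightarrow> 'v::ab_group_add \<Rightarrow> 'v) \<Rightarrow>
    ('v \<Rightarrow> 'v) \<Rightarrow> ('v \<Rightarrow> 'v) \<Rightarrow> ('v \<Rightarrow> 'v) \<Rightarrow> bool" where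
  "is_rep lp lq sc Ep Em H \<longleftrightarrow>
    Vector_Spaces.linear sc sc Ep \<and>
    Vector_Spaces.linear sc sc Em \<and>
    Vector_Spaces.linear sc sc H \<and>
    module.span sc {v. \<exists>m. H v = sc m v} = UNIV \<and>
    (\<forall>v. H (Ep v) - Ep (H v) = Ep v) \<and>
    (\<forall>v. H (Em v) - Em (H v) = - Em v) \<and>
    (\<forall>m v. H v = sc m v \<longrightarrow> Ep (Em v) - Em (Ep v) = sc (pqnum lp lq (2 * m)) v)"

definition subrep ::
  "(complex \<Rightarrow> 'v::ab_group_add \<Rightarrow> 'v) \<Rightarrow> ('v \<Rightarrow> 'v) \<Rightarrow> ('v \<Rightarrow> 'v) \<Rightarrow> ('v \<Rightarrow> 'v) \<Rightarrow>
    'v set \<Rightarrow> bool" where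
  "subrep sc Ep Em H S \<longleftrightarrow>
    module.subspace sc S \<and> Ep ` S \<subseteq> S \<and> Em ` S \<subseteq> S \<and> H ` S \<subseteq> S"

definition reducible ::
  "(complex \<Rightarrow> 'v::ab_group_add \<Rightarrow> 'v) \<Rightarrow> ('v \<Rightarrow> 'v) \<Rightarrow> ('v \<Rightarrow> 'v) \<Rightarrow> ('v \<Rightarrow> 'v) \<Rightarrow> bool" where
  "reducible sc Ep Em H \<longleftrightarrow> (\<exists>S. subrep sc Ep Em H S \<and> S \<noteq> {0} \<and> S \<noteq> UNIV)"

definition finite_dim :: "(complex \<Rightarrow> 'v::ab_group_add \<Rightarrow> 'v) \<Rightarrow> 'v set \<Rightarrow> bool" where
  "finite_dim sc S \<longleftrightarrow> (\<exists>B. finite B \<and> S = module.span sc B)"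

text \<open>The underlying space of $W_j$ is the space of finitely supported functions
  \<open>nat \<Rightarrow>\<^sub>0 complex\<close>; \<open>ket n\<close> is the basis vector $|j,j-n\rangle$.\<close>

type_synonym wspace = "nat \<Rightarrow>\<^sub>0 complex"

definition wscale :: "complex \<Rightarrow> wspace \<Rightarrow> wspace" where
  "wscale c v = Poly_Mapping.map ((*) c) v"

definition ket :: "nat \<Rightarrow> wspace" where
  "ket n = Poly_Mapping.single n 1"

definition lin_ext :: "(nat \<Rightarrow> wspace) \<Rightarrow> wspace \<Rightarrow> wspace" where
  "lin_ext g v = (\<Sum>n\<in>Poly_Mapping.keys v. wscale (Poly_Mapping.lookup v n) (g n))"

definition weight :: "complex \<Rightarrow> nat \<Rightarrow> complex" where
  "weight j n = j - of_nat n"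

text \<open>The numbers under the roots in the coefficients of $E_+$ and $E_-$ on $|j,m\rangle$,
  where $m = j-n$; the integers $j-m$ and $j-m+1$ are then $n$ and $n+1$.\<close>

definition up_radicand :: "complex \<Rightarrow> complex \<Rightarrow> complex \<Rightarrow> nat \<Rightarrow> complex" where
  "up_radicand lp lq j n = (let p = exp lp; q = exp lq; m = weight j n in
    (cpow lq (j + m + 1) * qnum q (int n) - cpow lp (- j - m - 1) * qnum p (int n))
      / (q - inverse p))"

definition down_radicand :: "complex \<Rightarrow> complex \<Rightarrow> complex \<Rightarrow> nat \<Rightarrow> complex" where
  "down_radicand lp lq j n = (let p = exp lp; q = exp lq; m = weight j n in
    (cpow lq (j + m) * qnum q (int n + 1) - cpow lp (- j - m) * qnum p (int n + 1))
      / (q - inverse p))"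

lemma up_radicand_Suc: "up_radicand lp lq j (Suc n) = down_radicand lp lq j n"
  by (simp add: up_radicand_def down_radicand_def weight_def Let_def algebra_simps)

text \<open>Here \<open>r n\<close> is the chosen square root of \<open>down_radicand lp lq j n\<close>, which by
  \<open>up_radicand_Suc\<close> is also a square root of \<open>up_radicand lp lq j (Suc n)\<close>. Hence the
  coefficient of $E_-$ on \<open>ket n\<close> is \<open>r n\<close>, and that of $E_+$ on \<open>ket (Suc n)\<close> is also \<open>r n\<close>.\<close>

definition W_Eplus :: "(nat \<Rightarrow> complex) \<Rightarrow> wspace \<Rightarrow> wspace" where
  "W_Eplus r = lin_ext (\<lambda>n. case n of 0 \<Rightarrow> 0 | Suc k \<Rightarrow> wscale (r k) (ket k))"

definition W_Eminus :: "(nat \<Rightarrow> complex) \<Rightarrow> wspace \<Rightarrow> wspace" where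
  "W_Eminus r = lin_ext (\<lambda>n. wscale (r n) (ket (Suc n)))"

definition W_H :: "complex \<Rightarrow> wspace \<Rightarrow> wspace" where
  "W_H j = lin_ext (\<lambda>n. wscale (weight j n) (ket n))"

lemma lookup_wscale [simp]: "Poly_Mapping.lookup (wscale c v) n = c * Poly_Mapping.lookup v n"
  by (simp add: wscale_def Poly_Mapping.map.rep_eq when_def)

lemma lookup_ket: "Poly_Mapping.lookup (ket n) k = (if n = k then 1 else 0)"
  by (simp add: ket_def lookup_single when_def)

lemma vector_space_wscale: "vector_space wscale"
  by unfold_locales (auto intro!: poly_mapping_eqI simp: lookup_add algebra_simps)

lemma lookup_lin_ext:
  assumes "finite A" "Poly_Mapping.keys v \<subseteq> A"
  shows "Poly_Mapping.lookup (lin_ext g v) k =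
    (\<Sum>n\<in>A. Poly_Mapping.lookup v n * Poly_Mapping.lookup (g n) k)"
proof -
  have "Poly_Mapping.lookup (lin_ext g v) k =
    (\<Sum>n\<in>Poly_Mapping.keys v. Poly_Mapping.lookup v n * Poly_Mapping.lookup (g n) k)"
    by (simp add: lin_ext_def lookup_sum)
  also have "\<dots> = (\<Sum>n\<in>A. Poly_Mapping.lookup v n * Poly_Mapping.lookup (g n) k)"
    using assms by (intro sum.mono_neutral_left) (auto simp: in_keys_iff)
  finally show ?thesis .
qed

lemma linear_lin_ext: "Vector_Spaces.linear wscale wscale (lin_ext g)"
proof -
  interpret vector_space wscale by (rule vector_space_wscale)
  show ?thesis
  proof unfold_locales
    fix u v :: wspace
    let ?A = "Poly_Mapping.keys u \<union> Poly_Mapping.keys v"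
    have k: "Poly_Mapping.keys (u + v) \<subseteq> ?A" by (rule keys_add)
    show "lin_ext g (u + v) = lin_ext g u + lin_ext g v"
      by (rule poly_mapping_eqI)
        (simp add: lookup_lin_ext[of ?A, OF _ k] lookup_lin_ext[of ?A u]
          lookup_lin_ext[of ?A v] lookup_add sum.distrib algebra_simps)
  next
    fix c and v :: wspace
    have k: "Poly_Mapping.keys (wscale c v) \<subseteq> Poly_Mapping.keys v"
      by (auto simp: in_keys_iff)
    show "lin_ext g (wscale c v) = wscale c (lin_ext g v)"
      by (rule poly_mapping_eqI)
        (simp add: lookup_lin_ext[OF _ k] lookup_lin_ext[of "Poly_Mapping.keys v" v]
          sum_distrib_left algebra_simps)
  qed
qed

lemma lin_ext_ket [simp]: "lin_ext g (ket n) = g n"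
  by (rule poly_mapping_eqI) (simp add: lin_ext_def ket_def)

lemma W_on_basis:
  "W_H j (ket n) = wscale (weight j n) (ket n)"
  "W_Eplus r (ket 0) = 0"
  "W_Eplus r (ket (Suc n)) = wscale (r n) (ket n)"
  "W_Eminus r (ket n) = wscale (r n) (ket (Suc n))"
  by (simp_all add: W_H_def W_Eplus_def W_Eminus_def)

lemma lookup_lin_ext_single:
  assumes "\<And>n. n \<noteq> i \<Longrightarrow> Poly_Mapping.lookup (g n) k = 0"
  shows "Poly_Mapping.lookup (lin_ext g v) k =
    Poly_Mapping.lookup v i * Poly_Mapping.lookup (g i) k"
proof -
  let ?A = "insert i (Poly_Mapping.keys v)"
  have "Poly_Mapping.lookup (lin_ext g v) k =
      (\<Sum>n\<in>?A. Poly_Mapping.lookup v n * Poly_Mapping.lookup (g n) k)"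
    by (rule lookup_lin_ext) auto
  also have "\<dots> = (\<Sum>n\<in>?A.
      if n = i then Poly_Mapping.lookup v i * Poly_Mapping.lookup (g i) k else 0)"
    by (intro sum.cong refl) (simp add: assms)
  finally show ?thesis by simp
qed

lemma lookup_W_H: "Poly_Mapping.lookup (W_H j v) k = weight j k * Poly_Mapping.lookup v k"
  unfolding W_H_def by (subst lookup_lin_ext_single[of k]) (auto simp: lookup_ket)

lemma lookup_W_Eplus:
  "Poly_Mapping.lookup (W_Eplus r v) k = r k * Poly_Mapping.lookup v (Suc k)"
  unfolding W_Eplus_def
  by (subst lookup_lin_ext_single[of "Suc k"]) (auto simp: lookup_ket split: nat.split)

lemma lookup_W_Eminus:
  "Poly_Mapping.lookup (W_Eminus r v) k =
    (case k of 0 \<Rightarrow> 0 | Suc l \<Rightarrow> r l * Poly_Mapping.lookup v l)"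
proof (cases k)
  case 0
  then show ?thesis
    unfolding W_Eminus_def by (subst lookup_lin_ext_single[of 0]) (auto simp: lookup_ket)
next
  case (Suc l)
  then show ?thesis
    unfolding W_Eminus_def by (subst lookup_lin_ext_single[of l]) (auto simp: lookup_ket)
qed

lemma span_ket: "module.span wscale (range ket) = UNIV"
proof -
  interpret vector_space wscale by (rule vector_space_wscale)
  have "v \<in> span (range ket)" for v
  proof -
    have "v = lin_ext ket v"
      by (rule poly_mapping_eqI)
        (simp add: lin_ext_def lookup_sum lookup_ket if_distrib in_keys_iff cong: if_cong)
    also have "\<dots> \<in> span (range ket)"
      unfolding lin_ext_def by (intro span_sum span_scale span_base) auto
    finally show ?thesis .
  qed
  then show ?thesis by blast
qed

lemma inj_ket: "inj ket"
  by (rule injI) (metis lookup_ket zero_neq_one)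

lemma independent_ket: "\<not> module.dependent wscale (range ket)"
proof -
  interpret vector_space wscale by (rule vector_space_wscale)
  show ?thesis
    unfolding independent_explicit_module
  proof (intro allI impI)
    fix t u w
    assume t: "finite t" "t \<subseteq> range ket" "(\<Sum>v\<in>t. wscale (u v) v) = 0" "w \<in> t"
    obtain n where w: "w = ket n"
      using t(2,4) by blast
    have "Poly_Mapping.lookup v n = (if v = ket n then 1 else 0)" if "v \<in> t" for v
      using that t(2) by (auto simp: lookup_ket inj_eq[OF inj_ket])
    then have "(\<Sum>v\<in>t. u v * Poly_Mapping.lookup v n) = (\<Sum>v\<in>t. if v = ket n then u v else 0)"
      by (intro sum.cong) auto
    also have "\<dots> = u (ket n)"
      using t(1,4) w by simp
    finally show "u w = 0"
      unfolding w using arg_cong[OF t(3), of "\<lambda>w. Poly_Mapping.lookup w n"] by (simp add: lookup_sum)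
  qed
qed

lemma qnum_step:
  assumes "q \<noteq> 0" "q\<^sup>2 \<noteq> 1"
  shows "qnum q (int n + 1) - q * qnum q (int n) = inverse q ^ n"
    and "qnum q (int n + 1) - inverse q * qnum q (int n) = q ^ n"
proof -
  have d: "q - inverse q \<noteq> 0"
    using assms by (auto simp: field_simps power2_eq_square)
  have e: "q powi (int n + 1) = q * q ^ n" "q powi (- (int n + 1)) = inverse q * inverse q ^ n"
    "q powi (- int n) = inverse q ^ n" "q powi (int n) = q ^ n"
    using assms(1) by (simp_all add: power_int_add power_int_minus power_int_diff power_inverse divide_inverse)
  define i where "i = inverse q"
  define Q R where "Q = q ^ n" and "R = i ^ n"
  note e' = e[folded i_def, folded Q_def R_def] and d' = d[folded i_def]
  have "(q * Q - i * R) - q * (Q - R) = R * (q - i)"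
    by (simp add: algebra_simps)
  then show "qnum q (int n + 1) - q * qnum q (int n) = inverse q ^ n"
    unfolding qnum_def i_def[symmetric] e' R_def[symmetric]
    using d' by (simp add: divide_simps)
  have "(q * Q - i * R) - i * (Q - R) = Q * (q - i)"
    by (simp add: algebra_simps)
  then show "qnum q (int n + 1) - inverse q * qnum q (int n) = q ^ n"
    unfolding qnum_def i_def[symmetric] e' Q_def[symmetric]
    using d' by (simp add: divide_simps)
qed

lemma down_minus_up_radicand:
  assumes "(exp lp)\<^sup>2 \<noteq> 1" "(exp lq)\<^sup>2 \<noteq> 1"
  shows "down_radicand lp lq j n - up_radicand lp lq j n = pqnum lp lq (2 * weight j n)"
proof -
  let ?m = "weight j n"
  have en: "exp (of_nat n * l) = exp l ^ n" for l :: complex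
    by (simp add: exp_of_nat_mult)
  have q1: "cpow lq (j + ?m + 1) = cpow lq (j + ?m) * exp lq"
    by (simp add: cpow_def distrib_right exp_add)
  have q2: "cpow lq (2 * ?m) = cpow lq (j + ?m) * inverse (exp lq) ^ n"
  proof -
    have "2 * ?m * lq = (j + ?m) * lq - of_nat n * lq"
      by (simp add: weight_def algebra_simps)
    then show ?thesis
      by (simp add: cpow_def exp_diff en divide_inverse power_inverse)
  qed
  have p1: "cpow lp (- j - ?m - 1) = cpow lp (- j - ?m) * inverse (exp lp)"
    by (simp add: cpow_def left_diff_distrib exp_diff divide_inverse)
  have p2: "cpow lp (- (2 * ?m)) = cpow lp (- j - ?m) * exp lp ^ n"
  proof -
    have "- (2 * ?m) * lp = (- j - ?m) * lp + of_nat n * lp"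
      by (simp add: weight_def algebra_simps)
    then show ?thesis
      unfolding cpow_def by (simp only: exp_add en)
  qed
  have a: "x / d - y / d = z / d" if "x - y = z" for x y z d :: complex
    using that by (simp add: diff_divide_distrib[symmetric])
  show ?thesis
    unfolding down_radicand_def up_radicand_def pqnum_def Let_def p1 p2 q1 q2
      qnum_step(1)[OF exp_not_eq_zero assms(2), symmetric]
      qnum_step(2)[OF exp_not_eq_zero assms(1), symmetric]
    by (rule a) (simp add: algebra_simps)
qed

lemma W_is_rep:
  assumes "(exp lp)\<^sup>2 \<noteq> 1" "(exp lq)\<^sup>2 \<noteq> 1"
    and r: "\<And>n. (r n)\<^sup>2 = down_radicand lp lq j n"
  shows "is_rep lp lq wscale (W_Eplus r) (W_Eminus r) (W_H j)"
  unfolding is_rep_def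
proof (intro conjI allI impI)
  interpret vector_space wscale by (rule vector_space_wscale)
  show "Vector_Spaces.linear wscale wscale (W_Eplus r)"
    "Vector_Spaces.linear wscale wscale (W_Eminus r)"
    "Vector_Spaces.linear wscale wscale (W_H j)"
    by (simp_all add: W_Eplus_def W_Eminus_def W_H_def linear_lin_ext)
  have "range ket \<subseteq> {v. \<exists>m. W_H j v = wscale m v}"
    using W_on_basis(1) by blast
  then show "span {v. \<exists>m. W_H j v = wscale m v} = UNIV"
    using span_mono span_ket by blast
  fix v
  show "W_H j (W_Eplus r v) - W_Eplus r (W_H j v) = W_Eplus r v"
    by (rule poly_mapping_eqI)
      (simp add: lookup_minus lookup_W_H lookup_W_Eplus weight_def algebra_simps)
  show "W_H j (W_Eminus r v) - W_Eminus r (W_H j v) = - W_Eminus r v"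
    by (rule poly_mapping_eqI)
      (simp add: lookup_minus lookup_W_H lookup_W_Eminus weight_def algebra_simps split: nat.split)
  fix m
  assume H: "W_H j v = wscale m v"
  show "W_Eplus r (W_Eminus r v) - W_Eminus r (W_Eplus r v) = wscale (pqnum lp lq (2 * m)) v"
  proof (rule poly_mapping_eqI)
    fix k
    let ?v = "Poly_Mapping.lookup v"
    have "weight j k * ?v k = m * ?v k"
      using arg_cong[OF H, of "\<lambda>w. Poly_Mapping.lookup w k"] by (simp add: lookup_W_H)
    then have m: "?v k = 0 \<or> m = weight j k"
      by auto
    have "Poly_Mapping.lookup (W_Eplus r (W_Eminus r v) - W_Eminus r (W_Eplus r v)) k =
        (down_radicand lp lq j k - up_radicand lp lq j k) * ?v k"
    proof (cases k)
      case 0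
      have "up_radicand lp lq j 0 = 0"
        by (simp add: up_radicand_def qnum_def)
      then show ?thesis
        by (simp add: 0 lookup_minus lookup_W_Eplus lookup_W_Eminus r[symmetric] power2_eq_square)
    next
      case (Suc l)
      show ?thesis
        by (simp add: Suc lookup_minus lookup_W_Eplus lookup_W_Eminus up_radicand_Suc
            r[symmetric] power2_eq_square algebra_simps)
    qed
    then show "Poly_Mapping.lookup (W_Eplus r (W_Eminus r v) - W_Eminus r (W_Eplus r v)) k =
        Poly_Mapping.lookup (wscale (pqnum lp lq (2 * m)) v) k"
      using m by (auto simp: down_minus_up_radicand[OF assms(1,2)])
  qed
qed

end

theory Submission
  imports Defs
begin

text \<open>Since $E_-$ maps $|j,j-n\rangle$ to a multiple of $|j,j-n-1\rangle$, it raises the top index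
  in the support of a vector unless the coefficient vanishes there. In a finite-dimensional invariant
  subspace the top index is bounded, so the coefficient vanishes at the largest index that occurs.
  Conversely, if it vanishes at $x$, the first $x+1$ basis vectors span an invariant subspace.\<close>

text \<open>The index counts steps down from the highest weight. Membership is stated by coordinates
  so that the \<open>lookup\<close> formulas for the operators apply directly.\<close>

definition truncation :: "nat \<Rightarrow> wspace set" where
  "truncation N = {v. \<forall>k>N. Poly_Mapping.lookup v k = 0}"

lemma subspace_truncation: "module.subspace wscale (truncation N)"
proof -
  interpret vector_space wscale by (rule vector_space_wscale)
  show ?thesis
    by (rule subspaceI) (auto simp: truncation_def lookup_add)
qed

text \<open>Expanding a vector in the basis uses only the indices of its support. This supplies the
  finite spanning set that \<open>finite_dim\<close> asks for.\<close>

lemma truncation_eq_span: "truncation N = module.span wscale (ket ` {..N})"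
proof -
  interpret vector_space wscale by (rule vector_space_wscale)
  have "v \<in> span (ket ` {..N})" if v: "v \<in> truncation N" for v
  proof -
    have keys: "Poly_Mapping.keys v \<subseteq> {..N}"
      using v by (force simp: truncation_def in_keys_iff not_le[symmetric])
    have "v = lin_ext ket v"
      by (rule poly_mapping_eqI)
        (simp add: lin_ext_def lookup_sum lookup_ket if_distrib in_keys_iff cong: if_cong)
    also have "\<dots> \<in> span (ket ` {..N})"
      unfolding lin_ext_def using keys by (intro span_sum span_scale span_base) auto
    finally show ?thesis .
  qed
  moreover have "span (ket ` {..N}) \<subseteq> truncation N"
    by (rule span_minimal[OF _ subspace_truncation]) (auto simp: truncation_def lookup_ket)
  ultimately show ?thesis by blast
qed

text \<open>Each of the finitely many generators has finite support, so one bound serves them all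
  and passes to their span.\<close>

lemma finite_dim_le_truncation:
  assumes "finite_dim wscale S"
  obtains N where "S \<subseteq> truncation N"
proof -
  interpret vector_space wscale by (rule vector_space_wscale)
  obtain B where B: "finite B" "S = span B"
    using assms by (auto simp: finite_dim_def)
  have "finite (\<Union>b\<in>B. Poly_Mapping.keys b)"
    using B(1) by simp
  then obtain N where "(\<Union>b\<in>B. Poly_Mapping.keys b) \<subseteq> {..N}"
    by (auto simp: finite_nat_set_iff_bounded_le)
  then have "B \<subseteq> truncation N"
    by (force simp: truncation_def in_keys_iff not_le[symmetric])
  then have "S \<subseteq> truncation N"
    unfolding B(2) by (rule span_minimal[OF _ subspace_truncation])
  then show thesis by (rule that)
qed

text \<open>\<open>W_H\<close> is diagonal and \<open>W_Eplus\<close> lowers indices, so only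
  \<open>W_Eminus\<close> could leave the subspace, and only by the step from \<open>ket x\<close>
  to \<open>ket (Suc x)\<close>, whose coefficient is \<open>r x\<close>.\<close>

lemma subrep_truncation:
  assumes "r x = 0"
  shows "subrep wscale (W_Eplus r) (W_Eminus r) (W_H j) (truncation x)"
  unfolding subrep_def
proof (intro conjI)
  show "W_Eminus r ` truncation x \<subseteq> truncation x"
  proof clarify
    fix v assume v: "v \<in> truncation x"
    have "Poly_Mapping.lookup (W_Eminus r v) k = 0" if "k > x" for k
    proof (cases k)
      case (Suc l)
      \<comment> \<open>Coordinate \<open>Suc l\<close> of the image is \<open>r l\<close> times
        coordinate \<open>l\<close> of \<open>v\<close>: the first factor vanishes for
        \<open>l = x\<close>, the second for \<open>l > x\<close>.\<close>
      then have "l = x \<or> l > x"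
        using that by auto
      then show ?thesis
        using v assms Suc by (auto simp: lookup_W_Eminus truncation_def)
    qed (use that in simp)
    then show "W_Eminus r v \<in> truncation x"
      by (simp add: truncation_def)
  qed
qed (rule subspace_truncation, auto simp: truncation_def lookup_W_Eplus lookup_W_H)

lemma W_coefficient_vanishes:
  assumes "module.subspace wscale S" "W_Eminus r ` S \<subseteq> S" "S \<noteq> {0}" "finite_dim wscale S"
  shows "\<exists>x. r x = 0"
proof -
  interpret vector_space wscale by (rule vector_space_wscale)
  obtain N where N: "S \<subseteq> truncation N"
    using finite_dim_le_truncation[OF assms(4)] .
  \<comment> \<open>Indices are collected over all of \<open>S\<close>, not over one vector, so that
    the maximum also bounds the support of \<open>W_Eminus r w\<close>.\<close>
  define D where "D = {d. \<exists>v\<in>S. Poly_Mapping.lookup v d \<noteq> 0}"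
  have "D \<subseteq> {..N}"
    using N by (force simp: D_def truncation_def not_le[symmetric])
  then have fin: "finite D"
    by (rule finite_subset) simp
  obtain v where "v \<in> S" "v \<noteq> 0"
    using assms(3) subspace_0[OF assms(1)] by blast
  then have "D \<noteq> {}"
    by (auto simp: D_def poly_mapping_eq_iff fun_eq_iff)
  then have "Max D \<in> D"
    using fin by (rule Max_in[rotated])
  then obtain w where w: "w \<in> S" "Poly_Mapping.lookup w (Max D) \<noteq> 0"
    by (auto simp: D_def)
  have "Suc (Max D) \<notin> D"
    using Max_ge[OF fin] by (meson Suc_n_not_le_n)
  moreover have "W_Eminus r w \<in> S"
    using w(1) assms(2) by blast
  ultimately have "Poly_Mapping.lookup (W_Eminus r w) (Suc (Max D)) = 0"
    by (auto simp: D_def)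
  \<comment> \<open>The vanishing coordinate is \<open>r (Max D)\<close> times the nonzero
    coordinate of \<open>w\<close> at \<open>Max D\<close>.\<close>
  then show ?thesis
    using w(2) by (auto simp: lookup_W_Eminus)
qed

text \<open>For m = j - x one has j + m = 2j - x, so the numerator of the radicand is f(x); the
  denominator is nonzero because pq differs from 1.\<close>

lemma down_radicand_eq_0_iff:
  assumes "exp lp * exp lq \<noteq> 1"
  shows "down_radicand lp lq j x = 0 \<longleftrightarrow>
    cpow lq (2 * j - of_nat x) * qnum (exp lq) (int x + 1)
      - cpow lp (- 2 * j + of_nat x) * qnum (exp lp) (int x + 1) = 0"
proof -
  have "exp lq - inverse (exp lp) \<noteq> 0"
    using assms by (simp add: field_simps)
  moreover have "j + weight j x = 2 * j - of_nat x" "- j - weight j x = - 2 * j + of_nat x"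
    by (simp_all add: weight_def)
  ultimately show ?thesis
    by (simp only: down_radicand_def Let_def divide_eq_0_iff simp_thms)
qed

theorem proposition2:
  fixes p q lp lq j :: complex and r :: "nat \<Rightarrow> complex"
  assumes "p \<noteq> 0" and "q \<noteq> 0"
    and "p\<^sup>2 \<noteq> q\<^sup>2" and "p * q \<noteq> 1" and "p\<^sup>2 \<noteq> 1" and "q\<^sup>2 \<noteq> 1"
    and "exp lp = p" and "exp lq = q"
    and "\<forall>n. (r n)\<^sup>2 = down_radicand lp lq j n"
  shows "(reducible wscale (W_Eplus r) (W_Eminus r) (W_H j) \<and>
          (\<exists>S. subrep wscale (W_Eplus r) (W_Eminus r) (W_H j) S \<and> S \<noteq> {0} \<and>
               finite_dim wscale S))
    \<longleftrightarrow> (\<exists>x::nat. cpow lq (2 * j - of_nat x) * qnum q (int x + 1)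
                   - cpow lp (- 2 * j + of_nat x) * qnum p (int x + 1) = 0)"
proof -
  let ?sub = "subrep wscale (W_Eplus r) (W_Eminus r) (W_H j)"
  \<comment> \<open>The choice of square roots is immaterial: a root vanishes exactly when its
    radicand does.\<close>
  have root: "r x = 0 \<longleftrightarrow> cpow lq (2 * j - of_nat x) * qnum q (int x + 1)
      - cpow lp (- 2 * j + of_nat x) * qnum p (int x + 1) = 0" for x
  proof -
    have "r x = 0 \<longleftrightarrow> (r x)\<^sup>2 = 0" by simp
    also have "\<dots> \<longleftrightarrow> down_radicand lp lq j x = 0"
      using assms(9) by simp
    finally show ?thesis
      using down_radicand_eq_0_iff[of lp lq j x] assms(4,7,8) by simp
  qed
  have "\<exists>x. r x = 0" if "?sub S" "S \<noteq> {0}" "finite_dim wscale S" for S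
    using that W_coefficient_vanishes[of S r] by (simp add: subrep_def)
  moreover have "reducible wscale (W_Eplus r) (W_Eminus r) (W_H j) \<and>
      (\<exists>S. ?sub S \<and> S \<noteq> {0} \<and> finite_dim wscale S)" if "r x = 0" for x
  proof -
    have sub: "?sub (truncation x)"
      using that by (rule subrep_truncation)
    have "ket 0 \<in> truncation x"
      by (simp add: truncation_def lookup_ket)
    moreover have "ket 0 \<noteq> 0"
      by (metis lookup_ket lookup_zero zero_neq_one)
    ultimately have nonzero: "truncation x \<noteq> {0}"
      by blast
    \<comment> \<open>The same subspace also witnesses reducibility, being proper.\<close>
    have "ket (Suc x) \<notin> truncation x"
      by (auto simp: truncation_def lookup_ket)
    then have "truncation x \<noteq> UNIV"
      by blast
    moreover have "finite_dim wscale (truncation x)"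
      unfolding finite_dim_def truncation_eq_span by blast
    ultimately show ?thesis
      using sub nonzero unfolding reducible_def by blast
  qed
  ultimately show ?thesis
    unfolding root[symmetric] by blast
qed

end
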